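(* Let $a_1,a_2\in\mathbb{R}$ with $a_2\neq0$, and let $\alpha=\alpha(x,t)$ be any smooth solution of the Fokker-Planck equation $$u_t=-a_2u-(a_2x+a_1)u_x+\tfrac12u_{xx}.$$ Then the functions $$f_1(x,t)=e^{-2a_2t}\big[\alpha_t-(a_2x+a_1)\alpha_x+2(a_2x+a_1)^2\alpha\big],$$ $$f_2(x,t)=\frac{e^{-a_2t}}{a_2}\Big(\frac12\alpha_x-(a_2x+a_1)\alpha\Big),$$ $$f_3(x,t)=e^{2a_2t}\big[\alpha_t+(a_2x+a_1)\alpha_x+a_2\alpha\big],$$ $$f_4(x,t)=\alpha_xe^{a_2t},\qquad f_5(x,t)=\alpha_t$$ are also solutions of the same Fokker-Planck equation.
   Context: The unknown $u$ is a real-valued function of the real variables $(x,t)$, and subscripts $x,t$ denote partial derivatives. *)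

theory Defs
  imports "HOL-Analysis.Analysis"
begin

text \<open>
  A function of two real variables is curried, \<open>u x t\<close>, with the space variable first;
  domains are sets of pairs \<open>(x, t)\<close>.
  Both partial derivatives are junk where the derivative does not exist, so existence has to be
  required separately; this is done in \<open>Ck_on\<close> below.
\<close>

definition Dx :: "(real \<Rightarrow> real \<Rightarrow> real) \<Rightarrow> real \<Rightarrow> real \<Rightarrow> real" where
  "Dx u x t = deriv (\<lambda>y. u y t) x"

definition Dt :: "(real \<Rightarrow> real \<Rightarrow> real) \<Rightarrow> real \<Rightarrow> real \<Rightarrow> real" where
  "Dt u x t = deriv (\<lambda>s. u x s) t"

text \<open>
  \<open>Ck_on k D u\<close>, meant for open \<open>D\<close>: all iterated partial derivatives of \<open>u\<close> of order at
  most \<open>k\<close>, taken in any order of the variables, exist and are continuous on \<open>D\<close>.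
\<close>

primrec Ck_on :: "nat \<Rightarrow> (real \<times> real) set \<Rightarrow> (real \<Rightarrow> real \<Rightarrow> real) \<Rightarrow> bool" where
  "Ck_on 0 D u \<longleftrightarrow> continuous_on D (\<lambda>(x, t). u x t)"
| "Ck_on (Suc k) D u \<longleftrightarrow>
     continuous_on D (\<lambda>(x, t). u x t) \<and>
     (\<forall>(x, t) \<in> D. (\<lambda>y. u y t) differentiable at x \<and> (\<lambda>s. u x s) differentiable at t) \<and>
     Ck_on k D (Dx u) \<and> Ck_on k D (Dt u)"

definition smooth_on :: "(real \<times> real) set \<Rightarrow> (real \<Rightarrow> real \<Rightarrow> real) \<Rightarrow> bool" where
  "smooth_on D u \<longleftrightarrow> (\<forall>k. Ck_on k D u)"

definition smooth_FP_solution ::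
  "real \<Rightarrow> real \<Rightarrow> (real \<times> real) set \<Rightarrow> (real \<Rightarrow> real \<Rightarrow> real) \<Rightarrow> bool" where
  "smooth_FP_solution a1 a2 D u \<longleftrightarrow>
     smooth_on D u \<and>
     (\<forall>(x, t) \<in> D.
        Dt u x t = - a2 * u x t - (a2 * x + a1) * Dx u x t + 1 / 2 * Dx (Dx u) x t)"

end

theory Submission
  imports Defs
begin

text \<open>
  Write \<open>p = a2 x + a1\<close>. The equation is \<open>u_t = (u_x / 2 - p u)_x\<close>, the forward equation of an
  Ornstein--Uhlenbeck process, and it has two first-order symmetries that act like the ladder
  operators of the harmonic oscillator:
  \<open>N u = e^(a2 t) u_x\<close> and \<open>M u = e^(- a2 t) (u_x / 2 - p u)\<close>.

  Both come from the same mechanism. The functions \<open>u_x\<close> and \<open>u_x / 2 - p u\<close> solve the equation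
  with the zeroth-order coefficient \<open>a2\<close> replaced by \<open>2 a2\<close> and by \<open>0\<close>, and multiplication
  by \<open>e^(c t)\<close> lowers that coefficient by \<open>c\<close>
  (lemmas \<open>exp_gauge\<close>, \<open>smooth_FP_solution_lowering\<close>, \<open>smooth_FP_solution_raising\<close>). The
  analytic input is the symmetry of the mixed partial derivatives (\<open>Dt_Dx_eq_Dx_Dt\<close>).

  The five functions are then combinations of iterated ladder operators. Using the equation to
  eliminate \<open>\<alpha>_xx\<close>, one finds \<open>f1 = 2 M (M \<alpha>)\<close>, \<open>f2 = M \<alpha> / a2\<close>, \<open>f3 = N (N \<alpha>) / 2\<close>,
  \<open>f4 = N \<alpha>\<close> and \<open>f5 = M (N \<alpha>) - a2 \<alpha>\<close>. The identities that use the equation are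
  claimed only on \<open>D\<close>, which suffices because being a solution on an open set depends only on the values there.
\<close>

section \<open>Partial derivatives on open sets\<close>

lemma open_slices:
  fixes D :: "(real \<times> real) set"
  assumes "open D"
  shows "open {y. (y, t) \<in> D}" "open {s. (x, s) \<in> D}"
proof -
  have "open ((\<lambda>y. (y, t)) -` D)"
    by (rule open_vimage[OF assms]) (intro continuous_intros)
  then show "open {y. (y, t) \<in> D}" by (simp add: vimage_def)
  have "open ((\<lambda>s. (x, s)) -` D)"
    by (rule open_vimage[OF assms]) (intro continuous_intros)
  then show "open {s. (x, s) \<in> D}" by (simp add: vimage_def)
qed

lemma eventually_slices:
  fixes D :: "(real \<times> real) set"
  assumes "open D" "(x, t) \<in> D"
  shows "eventually (\<lambda>y. (y, t) \<in> D) (nhds x)" "eventually (\<lambda>s. (x, s) \<in> D) (nhds t)"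
  using open_slices[OF assms(1)] assms(2) by (auto simp: eventually_nhds)

lemma partials_cong:
  fixes D :: "(real \<times> real) set" and u v :: "real \<Rightarrow> real \<Rightarrow> real"
  assumes "open D" "(x, t) \<in> D" and eq: "\<And>x t. (x, t) \<in> D \<Longrightarrow> u x t = v x t"
  shows "Dx u x t = Dx v x t" "Dt u x t = Dt v x t"
  unfolding Dx_def Dt_def
  by (rule deriv_cong_ev[OF _ refl], rule eventually_mono[OF eventually_slices(1)[OF assms(1,2)]],
      erule eq)
    (rule deriv_cong_ev[OF _ refl], rule eventually_mono[OF eventually_slices(2)[OF assms(1,2)]],
      erule eq)

lemma differentiable_slices_cong:
  fixes D :: "(real \<times> real) set" and u v :: "real \<Rightarrow> real \<Rightarrow> real"
  assumes "open D" "(x, t) \<in> D" and eq: "\<And>x t. (x, t) \<in> D \<Longrightarrow> u x t = v x t"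
  shows "(\<lambda>y. u y t) differentiable at x \<Longrightarrow> (\<lambda>y. v y t) differentiable at x"
    and "(\<lambda>s. u x s) differentiable at t \<Longrightarrow> (\<lambda>s. v x s) differentiable at t"
proof -
  have 1: "eventually (\<lambda>y. u y t = v y t) (nhds x)"
    using eventually_slices(1)[OF assms(1,2)] by eventually_elim (rule eq)
  have 2: "eventually (\<lambda>s. u x s = v x s) (nhds t)"
    using eventually_slices(2)[OF assms(1,2)] by eventually_elim (rule eq)
  show "(\<lambda>y. u y t) differentiable at x \<Longrightarrow> (\<lambda>y. v y t) differentiable at x"
    using DERIV_cong_ev[OF refl 1 refl] by (auto simp: real_differentiable_def)
  show "(\<lambda>s. u x s) differentiable at t \<Longrightarrow> (\<lambda>s. v x s) differentiable at t"
    using DERIV_cong_ev[OF refl 2 refl] by (auto simp: real_differentiable_def)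
qed

lemma Ck_on_cong:
  assumes "open D" "Ck_on k D u" and "\<And>x t. (x, t) \<in> D \<Longrightarrow> u x t = v x t"
  shows "Ck_on k D v"
  using assms(2,3)
proof (induction k arbitrary: u v)
  case 0
  show ?case
    unfolding Ck_on.simps
    by (rule continuous_on_eq[of _ "\<lambda>(x, t). u x t"]) (use 0 in auto)
next
  case (Suc k)
  have "continuous_on D (\<lambda>(x, t). v x t)"
    by (rule continuous_on_eq[of _ "\<lambda>(x, t). u x t"]) (use Suc.prems in auto)
  moreover have "Ck_on k D (Dx v)" "Ck_on k D (Dt v)"
    using Suc.prems Suc.IH[of "Dx u" "Dx v"] Suc.IH[of "Dt u" "Dt v"]
      partials_cong[OF assms(1), of _ _ u v] by auto
  moreover have "(\<lambda>y. v y t) differentiable at x \<and> (\<lambda>s. v x s) differentiable at t"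
    if "(x, t) \<in> D" for x t
    using differentiable_slices_cong[OF assms(1) that, of u v] Suc.prems that by auto
  ultimately show ?case by auto
qed

section \<open>The algebra of smooth functions\<close>

lemma smooth_on_cong:
  assumes "open D" "smooth_on D u" "\<And>x t. (x, t) \<in> D \<Longrightarrow> u x t = v x t"
  shows "smooth_on D v"
  using assms Ck_on_cong unfolding smooth_on_def by blast

lemma smooth_on_partials:
  assumes "smooth_on D u"
  shows "smooth_on D (Dx u)" "smooth_on D (Dt u)"
  using assms unfolding smooth_on_def by (metis Ck_on.simps(2))+

lemma smooth_on_continuous: "smooth_on D u \<Longrightarrow> continuous_on D (\<lambda>(x, t). u x t)"
  unfolding smooth_on_def by (metis Ck_on.simps(1))

lemma Ck_on_Suc_DERIV:
  assumes "Ck_on (Suc k) D u" "(x, t) \<in> D"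
  shows "((\<lambda>y. u y t) has_field_derivative Dx u x t) (at x)"
    and "((\<lambda>s. u x s) has_field_derivative Dt u x t) (at t)"
  using assms unfolding Dx_def Dt_def
  by (auto simp: DERIV_deriv_iff_real_differentiable)

lemma smooth_on_DERIV:
  assumes "smooth_on D u" "(x, t) \<in> D"
  shows "((\<lambda>y. u y t) has_field_derivative Dx u x t) (at x)"
    and "((\<lambda>s. u x s) has_field_derivative Dt u x t) (at t)"
  using assms Ck_on_Suc_DERIV[of 0 D u x t] unfolding smooth_on_def by blast+

lemma Ck_on_Suc_imp_Ck_on: "Ck_on (Suc k) D u \<Longrightarrow> Ck_on k D u"
proof (induction k arbitrary: u)
  case (Suc k)
  have "Ck_on k D (Dx u)" "Ck_on k D (Dt u)"
    using Suc.prems Suc.IH Ck_on.simps(2)[of "Suc k" D u] by blast+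
  then show ?case using Suc.prems unfolding Ck_on.simps(2)[of _ D u] by blast
qed simp

text \<open>
  The step of every closure proof below: partial derivatives known explicitly on \<open>D\<close> may
  replace the functions \<open>Dx u\<close> and \<open>Dt u\<close>, which are not controlled outside \<open>D\<close>.
\<close>

lemma Ck_on_SucI:
  assumes "open D" "continuous_on D (\<lambda>(x, t). u x t)"
    and dx: "\<And>x t. (x, t) \<in> D \<Longrightarrow> ((\<lambda>y. u y t) has_field_derivative v x t) (at x)"
    and dt: "\<And>x t. (x, t) \<in> D \<Longrightarrow> ((\<lambda>s. u x s) has_field_derivative w x t) (at t)"
    and "Ck_on k D v" "Ck_on k D w"
  shows "Ck_on (Suc k) D u"
proof -
  have "Ck_on k D (Dx u)"
    by (rule Ck_on_cong[OF assms(1,5)]) (simp add: Dx_def DERIV_imp_deriv[OF dx])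
  moreover have "Ck_on k D (Dt u)"
    by (rule Ck_on_cong[OF assms(1,6)]) (simp add: Dt_def DERIV_imp_deriv[OF dt])
  ultimately show ?thesis
    using assms(2) dx dt unfolding Ck_on.simps real_differentiable_def by blast
qed

lemma Ck_on_add:
  assumes "open D"
  shows "Ck_on k D u \<Longrightarrow> Ck_on k D v \<Longrightarrow> Ck_on k D (\<lambda>x t. u x t + v x t)"
proof (induction k arbitrary: u v)
  case 0
  then show ?case by (auto simp: split_def intro: continuous_intros)
next
  case (Suc k)
  show ?case
  proof (rule Ck_on_SucI[OF assms])
    show "continuous_on D (\<lambda>(x, t). u x t + v x t)"
      using Suc.prems by (auto simp: split_def intro: continuous_intros)
    show "Ck_on k D (\<lambda>x t. Dx u x t + Dx v x t)" "Ck_on k D (\<lambda>x t. Dt u x t + Dt v x t)"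
      using Suc.prems by (auto intro!: Suc.IH)
  qed (intro DERIV_add Ck_on_Suc_DERIV[OF Suc.prems(1)] Ck_on_Suc_DERIV[OF Suc.prems(2)];
      assumption)+
qed

lemma Ck_on_mult:
  assumes "open D"
  shows "Ck_on k D u \<Longrightarrow> Ck_on k D v \<Longrightarrow> Ck_on k D (\<lambda>x t. u x t * v x t)"
proof (induction k arbitrary: u v)
  case 0
  then show ?case by (auto simp: split_def intro: continuous_intros)
next
  case (Suc k)
  have uv: "Ck_on k D u" "Ck_on k D v" using Suc.prems Ck_on_Suc_imp_Ck_on by blast+
  show ?case
  proof (rule Ck_on_SucI[OF assms])
    show "continuous_on D (\<lambda>(x, t). u x t * v x t)"
      using Suc.prems by (auto simp: split_def intro: continuous_intros)
    show "Ck_on k D (\<lambda>x t. u x t * Dx v x t + Dx u x t * v x t)"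
      by (rule Ck_on_add[OF assms Suc.IH Suc.IH]) (use Suc.prems uv in simp_all)
    show "Ck_on k D (\<lambda>x t. u x t * Dt v x t + Dt u x t * v x t)"
      by (rule Ck_on_add[OF assms Suc.IH Suc.IH]) (use Suc.prems uv in simp_all)
    show "((\<lambda>y. u y t * v y t) has_field_derivative u x t * Dx v x t + Dx u x t * v x t) (at x)"
      and "((\<lambda>s. u x s * v x s) has_field_derivative u x t * Dt v x t + Dt u x t * v x t) (at t)"
      if "(x, t) \<in> D" for x t
      using DERIV_mult'[OF Ck_on_Suc_DERIV(1)[OF Suc.prems(1) that]
          Ck_on_Suc_DERIV(1)[OF Suc.prems(2) that]]
        DERIV_mult'[OF Ck_on_Suc_DERIV(2)[OF Suc.prems(1) that]
          Ck_on_Suc_DERIV(2)[OF Suc.prems(2) that]] .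
  qed
qed

lemma Ck_on_const: "open D \<Longrightarrow> Ck_on k D (\<lambda>x t. c)"
proof (induction k arbitrary: c)
  case (Suc k)
  note zero = Suc.IH[OF Suc.prems, of 0]
  show ?case
    by (rule Ck_on_SucI[OF Suc.prems _ _ _ zero zero]) (auto simp: split_def)
qed simp

lemma Ck_on_fst:
  assumes "open D"
  shows "Ck_on k D (\<lambda>x t. x)"
proof (cases k)
  case 0
  then show ?thesis by (simp add: split_def continuous_on_fst)
next
  case (Suc k')
  show ?thesis
    unfolding Suc
    by (rule Ck_on_SucI[OF assms _ _ _ Ck_on_const[OF assms, of _ 1] Ck_on_const[OF assms, of _ 0]])
      (simp_all add: split_def continuous_on_fst)
qed

lemma Ck_on_exp_snd:
  assumes "open D"
  shows "Ck_on k D (\<lambda>x t. exp (c * t))"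
proof (induction k)
  case 0
  show ?case unfolding Ck_on.simps split_def by (intro continuous_intros)
next
  case (Suc k)
  show ?case
  proof (rule Ck_on_SucI[OF assms])
    show "Ck_on k D (\<lambda>x t. 0)"
      by (rule Ck_on_const[OF assms])
    show "Ck_on k D (\<lambda>x t. c * exp (c * t))"
      by (rule Ck_on_mult[OF assms Ck_on_const[OF assms] Suc])
    show "continuous_on D (\<lambda>(x, t). exp (c * t))"
      unfolding split_def by (intro continuous_intros)
    show "((\<lambda>y. exp (c * t)) has_field_derivative 0) (at x)"
      "((\<lambda>s. exp (c * s)) has_field_derivative c * exp (c * t)) (at t)" for x t :: real
      by (auto intro!: derivative_eq_intros)
  qed
qed

lemma smooth_on_add:
  "open D \<Longrightarrow> smooth_on D u \<Longrightarrow> smooth_on D v \<Longrightarrow> smooth_on D (\<lambda>x t. u x t + v x t)"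
  and smooth_on_mult:
  "open D \<Longrightarrow> smooth_on D u \<Longrightarrow> smooth_on D v \<Longrightarrow> smooth_on D (\<lambda>x t. u x t * v x t)"
  and smooth_on_const: "open D \<Longrightarrow> smooth_on D (\<lambda>x t. c)"
  and smooth_on_fst: "open D \<Longrightarrow> smooth_on D (\<lambda>x t. x)"
  and smooth_on_exp_snd: "open D \<Longrightarrow> smooth_on D (\<lambda>x t. exp (c * t))"
  unfolding smooth_on_def
  by (simp_all add: Ck_on_add Ck_on_mult Ck_on_const Ck_on_fst Ck_on_exp_snd)

section \<open>Symmetry of the mixed partial derivatives\<close>

text \<open>
  Applying the mean value theorem to \<open>u(y, t + h) - u(y, t)\<close> in \<open>y\<close>, and then to
  the resulting difference of \<open>u1\<close> in time, reduces the second difference of \<open>u\<close> over a square to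
  one value of the mixed derivative.
\<close>

lemma second_difference_mvt:
  fixes u u1 u2 :: "real \<Rightarrow> real \<Rightarrow> real"
  assumes "h > 0"
    and d1: "\<And>y s. y \<in> {x..x+h} \<Longrightarrow> s \<in> {t..t+h} \<Longrightarrow>
      ((\<lambda>y. u y s) has_field_derivative u1 y s) (at y)"
    and d2: "\<And>y s. y \<in> {x..x+h} \<Longrightarrow> s \<in> {t..t+h} \<Longrightarrow>
      ((\<lambda>s. u1 y s) has_field_derivative u2 y s) (at s)"
  obtains y s where "y \<in> {x..x+h}" "s \<in> {t..t+h}"
    "u (x+h) (t+h) - u (x+h) t - u x (t+h) + u x t = h * h * u2 y s"
proof -
  have "\<exists>y>x. y < x + h \<and>
    (u (x+h) (t+h) - u (x+h) t) - (u x (t+h) - u x t) = (x + h - x) * (u1 y (t+h) - u1 y t)"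
    by (rule MVT2) (use assms(1) in \<open>auto intro!: DERIV_diff d1\<close>)
  then obtain y where y: "x < y" "y < x + h"
    "(u (x+h) (t+h) - u (x+h) t) - (u x (t+h) - u x t) = h * (u1 y (t+h) - u1 y t)"
    by auto
  have "\<exists>s>t. s < t + h \<and> u1 y (t+h) - u1 y t = (t + h - t) * u2 y s"
    by (rule MVT2) (use assms(1) y in \<open>auto intro!: d2\<close>)
  then obtain s where s: "t < s" "s < t + h" "u1 y (t+h) - u1 y t = h * u2 y s"
    by auto
  show thesis
    by (rule that[of y s]) (use y s in auto)
qed

text \<open>
  The second difference is symmetric in the two variables, so on every small square the two mixed
  derivatives share a value, though perhaps at different points. If they differed at \<open>(x, t)\<close>,
  continuity would separate them by a constant \<open>c\<close> throughout a small square.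
\<close>

lemma mixed_partials_eq:
  fixes u :: "real \<Rightarrow> real \<Rightarrow> real"
  assumes "open D" "(x, t) \<in> D"
    and "\<And>x t. (x, t) \<in> D \<Longrightarrow> ((\<lambda>y. u y t) has_field_derivative ux x t) (at x)"
    and "\<And>x t. (x, t) \<in> D \<Longrightarrow> ((\<lambda>s. u x s) has_field_derivative ut x t) (at t)"
    and "\<And>x t. (x, t) \<in> D \<Longrightarrow> ((\<lambda>s. ux x s) has_field_derivative uxt x t) (at t)"
    and "\<And>x t. (x, t) \<in> D \<Longrightarrow> ((\<lambda>y. ut y t) has_field_derivative utx x t) (at x)"
    and cont: "continuous_on D (\<lambda>(x, t). uxt x t)" "continuous_on D (\<lambda>(x, t). utx x t)"
  shows "uxt x t = utx x t"
proof -
  have square: "\<exists>h>0. {x..x+h} \<times> {t..t+h} \<subseteq> S" if S: "open S" "(x, t) \<in> S" for S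
  proof -
    obtain A B where AB: "open A" "open B" "x \<in> A" "t \<in> B" "A \<times> B \<subseteq> S"
      using S by (auto elim!: open_prod_elim)
    obtain d where d: "d > 0" "cball x d \<subseteq> A" using AB open_contains_cball by metis
    obtain e where e: "e > 0" "cball t e \<subseteq> B" using AB open_contains_cball by metis
    have "{x..x + min d e} \<subseteq> A" "{t..t + min d e} \<subseteq> B"
      using d e by (auto simp: cball_def dist_real_def subset_iff)
    then show ?thesis
      using AB(5) d(1) e(1) by (intro exI[of _ "min d e"]) auto
  qed
  have sep: False
    if fg: "continuous_on D (\<lambda>(x, t). f x t)" "continuous_on D (\<lambda>(x, t). g x t)"
      and lt: "f x t < g x t"
      and common: "\<And>h. h > 0 \<Longrightarrow> {x..x+h} \<times> {t..t+h} \<subseteq> D \<Longrightarrow>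
        \<exists>y s y' s'. y \<in> {x..x+h} \<and> s \<in> {t..t+h} \<and> y' \<in> {x..x+h} \<and> s' \<in> {t..t+h} \<and>
          f y s = g y' s'"
    for f g :: "real \<Rightarrow> real \<Rightarrow> real"
  proof -
    obtain c where c: "f x t < c" "c < g x t" using lt dense by blast
    have "open (D \<inter> (\<lambda>(x, t). f x t) -` {..<c})" "open (D \<inter> (\<lambda>(x, t). g x t) -` {c<..})"
      using continuous_open_preimage[OF fg(1) assms(1) open_lessThan]
        continuous_open_preimage[OF fg(2) assms(1) open_greaterThan] .
    then have "open ((D \<inter> (\<lambda>(x, t). f x t) -` {..<c}) \<inter> (D \<inter> (\<lambda>(x, t). g x t) -` {c<..}))"
      by blast
    from square[OF this] obtain h where h: "h > 0"
      "{x..x+h} \<times> {t..t+h} \<subseteq> (D \<inter> (\<lambda>(x, t). f x t) -` {..<c}) \<inter> (D \<inter> (\<lambda>(x, t). g x t) -` {c<..})"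
      using assms(2) c by auto
    obtain y s y' s' where "y \<in> {x..x+h}" "s \<in> {t..t+h}" "y' \<in> {x..x+h}" "s' \<in> {t..t+h}"
      "f y s = g y' s'"
      using common[OF h(1)] h(2) by blast
    moreover from this have "f y s < c" "c < g y' s'" using h(2) by fastforce+
    ultimately show False by simp
  qed
  have common: "\<exists>y s y' s'. y \<in> {x..x+h} \<and> s \<in> {t..t+h} \<and> y' \<in> {x..x+h} \<and> s' \<in> {t..t+h} \<and>
      uxt y s = utx y' s'"
    if h: "h > 0" "{x..x+h} \<times> {t..t+h} \<subseteq> D" for h
  proof -
    have D: "(y, s) \<in> D" if "y \<in> {x..x+h}" "s \<in> {t..t+h}" for y s
      using h(2) that by blast
    obtain y s where 1: "y \<in> {x..x+h}" "s \<in> {t..t+h}"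
      "u (x+h) (t+h) - u (x+h) t - u x (t+h) + u x t = h * h * uxt y s"
      by (rule second_difference_mvt[of h x t u ux uxt]) (use assms(3,5) D h(1) in auto)
    obtain s' y' where 2: "s' \<in> {t..t+h}" "y' \<in> {x..x+h}"
      "u (x+h) (t+h) - u x (t+h) - u (x+h) t + u x t = h * h * utx y' s'"
      by (rule second_difference_mvt[of h t x "\<lambda>s y. u y s" "\<lambda>s y. ut y s" "\<lambda>s y. utx y s"])
        (use assms(4,6) D h(1) in auto)
    from 1(3) 2(3) have "h * h * uxt y s = h * h * utx y' s'" by linarith
    then have "uxt y s = utx y' s'" using h(1) by simp
    with 1 2 show ?thesis by blast
  qed
  show ?thesis
  proof (rule ccontr)
    assume "uxt x t \<noteq> utx x t"
    then consider "uxt x t < utx x t" | "utx x t < uxt x t" by linarith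
    then show False
    proof cases
      case 1
      then show False by (rule sep[OF cont _ common])
    next
      case 2
      then show False by (rule sep[OF cont(2,1)]) (metis common)
    qed
  qed
qed

lemma Dt_Dx_eq_Dx_Dt:
  assumes "open D" "smooth_on D u" "(x, t) \<in> D"
  shows "Dt (Dx u) x t = Dx (Dt u) x t"
proof -
  note sm = assms(2) smooth_on_partials[OF assms(2)]
  show ?thesis
    by (rule mixed_partials_eq[OF assms(1,3) smooth_on_DERIV[OF sm(1)] smooth_on_DERIV(2)[OF sm(2)]
          smooth_on_DERIV(1)[OF sm(3)] smooth_on_continuous[OF smooth_on_partials(2)[OF sm(2)]]
          smooth_on_continuous[OF smooth_on_partials(1)[OF sm(3)]]])
qed

section \<open>Ladder operators for the Fokker-Planck equation\<close>

lemma partials_eqI: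
  "((\<lambda>y. u y t) has_field_derivative a) (at x) \<Longrightarrow> Dx u x t = a"
  "((\<lambda>s. u x s) has_field_derivative b) (at t) \<Longrightarrow> Dt u x t = b"
  by (simp_all add: Dx_def Dt_def DERIV_imp_deriv)

lemma smooth_FP_solution_cong:
  assumes D: "open D" and u: "smooth_FP_solution a1 a2 D u"
    and eq: "\<And>x t. (x, t) \<in> D \<Longrightarrow> u x t = v x t"
  shows "smooth_FP_solution a1 a2 D v"
proof -
  have "Dx u x t = Dx v x t" "Dt u x t = Dt v x t" if "(x, t) \<in> D" for x t
    using partials_cong[OF D that eq] by auto
  moreover from this have "Dx (Dx u) x t = Dx (Dx v) x t" if "(x, t) \<in> D" for x t
    using partials_cong(1)[OF D that] by blast
  ultimately show ?thesis
    using u smooth_on_cong[OF D _ eq] eq unfolding smooth_FP_solution_def by auto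
qed

lemma smooth_FP_solution_linear_combination:
  assumes D: "open D" and u: "smooth_FP_solution a1 a2 D u" and v: "smooth_FP_solution a1 a2 D v"
  shows "smooth_FP_solution a1 a2 D (\<lambda>x t. b * u x t + c * v x t)"
proof -
  let ?w = "\<lambda>x t. b * u x t + c * v x t"
  have sm: "smooth_on D u" "smooth_on D v"
    using u v by (auto simp: smooth_FP_solution_def)
  note d = smooth_on_DERIV[OF sm(1)] smooth_on_DERIV[OF sm(2)]
    smooth_on_DERIV[OF smooth_on_partials(1)[OF sm(1)]]
    smooth_on_DERIV[OF smooth_on_partials(1)[OF sm(2)]]
  have wx: "Dx ?w x t = b * Dx u x t + c * Dx v x t"
    and wt: "Dt ?w x t = b * Dt u x t + c * Dt v x t" if "(x, t) \<in> D" for x t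
    by (rule partials_eqI, auto intro!: derivative_eq_intros d that)+
  have wxx: "Dx (Dx ?w) x t = b * Dx (Dx u) x t + c * Dx (Dx v) x t" if "(x, t) \<in> D" for x t
    by (rule trans[OF partials_cong(1)[OF D that wx]], assumption, rule partials_eqI)
      (auto intro!: derivative_eq_intros d that)
  have "smooth_on D ?w"
    by (intro smooth_on_add smooth_on_mult smooth_on_const D sm)
  moreover have "Dt ?w x t = - a2 * ?w x t - (a2 * x + a1) * Dx ?w x t + 1 / 2 * Dx (Dx ?w) x t"
    if "(x, t) \<in> D" for x t
  proof -
    have "Dt u x t = - a2 * u x t - (a2 * x + a1) * Dx u x t + 1 / 2 * Dx (Dx u) x t"
      "Dt v x t = - a2 * v x t - (a2 * x + a1) * Dx v x t + 1 / 2 * Dx (Dx v) x t"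
      using u v that by (auto simp: smooth_FP_solution_def)
    then show ?thesis unfolding wx[OF that] wt[OF that] wxx[OF that] by algebra
  qed
  ultimately show ?thesis unfolding smooth_FP_solution_def by auto
qed

lemma smooth_FP_solution_scale:
  assumes "open D" "smooth_FP_solution a1 a2 D u"
  shows "smooth_FP_solution a1 a2 D (\<lambda>x t. b * u x t)"
  using smooth_FP_solution_linear_combination[OF assms(1,2,2), of b 0] by simp

text \<open>
  The factor \<open>exp (c * t)\<close> commutes with the space derivatives and contributes \<open>c * w\<close> to the
  time derivative, so it absorbs an excess \<open>c\<close> in the zeroth-order coefficient.
\<close>

lemma exp_gauge:
  assumes D: "open D" and w: "smooth_on D w"
    and eq: "\<And>x t. (x, t) \<in> D \<Longrightarrow>
      Dt w x t = - (a2 + c) * w x t - (a2 * x + a1) * Dx w x t + 1 / 2 * Dx (Dx w) x t"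
  shows "smooth_FP_solution a1 a2 D (\<lambda>x t. exp (c * t) * w x t)"
proof -
  let ?v = "\<lambda>x t. exp (c * t) * w x t"
  note d = smooth_on_DERIV[OF w] smooth_on_DERIV[OF smooth_on_partials(1)[OF w]]
  have vx: "Dx ?v x t = exp (c * t) * Dx w x t"
    and vt: "Dt ?v x t = exp (c * t) * (c * w x t + Dt w x t)" if "(x, t) \<in> D" for x t
    by (rule partials_eqI, auto intro!: derivative_eq_intros d that simp: algebra_simps)+
  have vxx: "Dx (Dx ?v) x t = exp (c * t) * Dx (Dx w) x t" if "(x, t) \<in> D" for x t
    by (rule trans[OF partials_cong(1)[OF D that vx]], assumption, rule partials_eqI)
      (auto intro!: derivative_eq_intros d that)
  have "smooth_on D ?v"
    by (intro smooth_on_mult smooth_on_exp_snd D w)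
  moreover have "Dt ?v x t = - a2 * ?v x t - (a2 * x + a1) * Dx ?v x t + 1 / 2 * Dx (Dx ?v) x t"
    if "(x, t) \<in> D" for x t
    unfolding vx[OF that] vt[OF that] vxx[OF that] eq[OF that] by (simp add: algebra_simps)
  ultimately show ?thesis unfolding smooth_FP_solution_def by auto
qed

text \<open>
  Differentiating the equation in \<open>x\<close> differentiates the drift too, which adds a second
  copy of \<open>a2\<close> to the zeroth-order coefficient.
\<close>

lemma smooth_FP_solution_lowering:
  assumes D: "open D" and u: "smooth_FP_solution a1 a2 D u"
  shows "smooth_FP_solution a1 a2 D (\<lambda>x t. exp (a2 * t) * Dx u x t)"
proof (rule exp_gauge[OF D])
  have sm: "smooth_on D u" using u by (simp add: smooth_FP_solution_def)
  note sx = smooth_on_partials(1)[OF sm]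
  note sxx = smooth_on_partials(1)[OF sx]
  note d = smooth_on_DERIV(1)[OF sm] smooth_on_DERIV(1)[OF sx] smooth_on_DERIV(1)[OF sxx]
  show "smooth_on D (Dx u)" by (rule sx)
  fix x t assume xt: "(x, t) \<in> D"
  have ut: "Dt u x t = - a2 * u x t - (a2 * x + a1) * Dx u x t + 1 / 2 * Dx (Dx u) x t"
    if "(x, t) \<in> D" for x t using u that by (auto simp: smooth_FP_solution_def)
  have "Dt (Dx u) x t = Dx (Dt u) x t" by (rule Dt_Dx_eq_Dx_Dt[OF D sm xt])
  also have "\<dots> = Dx (\<lambda>x t. - a2 * u x t - (a2 * x + a1) * Dx u x t + 1 / 2 * Dx (Dx u) x t) x t"
    by (rule partials_cong(1)[OF D xt ut])
  also have "\<dots> = - (a2 + a2) * Dx u x t - (a2 * x + a1) * Dx (Dx u) x t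
      + 1 / 2 * Dx (Dx (Dx u)) x t"
    by (rule partials_eqI) (auto intro!: derivative_eq_intros d xt simp: algebra_simps)
  finally show "Dt (Dx u) x t = - (a2 + a2) * Dx u x t - (a2 * x + a1) * Dx (Dx u) x t
      + 1 / 2 * Dx (Dx (Dx u)) x t" .
qed

text \<open>
  For \<open>w = u_x / 2 - p u\<close> the equation reads \<open>w_x = u_t\<close>. Hence
  \<open>w_t = u_xt / 2 - p u_t = w_xx / 2 - p w_x\<close>, with no zeroth-order term.
\<close>

lemma smooth_FP_solution_raising:
  assumes D: "open D" and u: "smooth_FP_solution a1 a2 D u"
  shows "smooth_FP_solution a1 a2 D
    (\<lambda>x t. exp (- a2 * t) * (1 / 2 * Dx u x t - (a2 * x + a1) * u x t))"
proof (rule exp_gauge[OF D])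
  let ?w = "\<lambda>x t. 1 / 2 * Dx u x t - (a2 * x + a1) * u x t"
  have sm: "smooth_on D u" using u by (simp add: smooth_FP_solution_def)
  note sx = smooth_on_partials(1)[OF sm]
  note d = smooth_on_DERIV[OF sm] smooth_on_DERIV[OF sx]
  have "smooth_on D (\<lambda>x t. 1 / 2 * Dx u x t + (-1) * ((a2 * x + a1) * u x t))"
    by (intro smooth_on_add smooth_on_mult smooth_on_const smooth_on_fst D sm sx)
  then show "smooth_on D ?w" by simp
  have ut: "Dt u x t = - a2 * u x t - (a2 * x + a1) * Dx u x t + 1 / 2 * Dx (Dx u) x t"
    if "(x, t) \<in> D" for x t using u that by (auto simp: smooth_FP_solution_def)
  have wx: "Dx ?w x t = Dt u x t" if "(x, t) \<in> D" for x t
    unfolding ut[OF that]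
    by (rule partials_eqI) (auto intro!: derivative_eq_intros d that simp: algebra_simps)
  fix x t assume xt: "(x, t) \<in> D"
  have "Dx (Dx ?w) x t = Dt (Dx u) x t"
    using partials_cong(1)[OF D xt wx] Dt_Dx_eq_Dx_Dt[OF D sm xt] by simp
  moreover have "Dt ?w x t = 1 / 2 * Dt (Dx u) x t - (a2 * x + a1) * Dt u x t"
    by (rule partials_eqI) (auto intro!: derivative_eq_intros d xt)
  ultimately show "Dt ?w x t = - (a2 + - a2) * ?w x t - (a2 * x + a1) * Dx ?w x t
      + 1 / 2 * Dx (Dx ?w) x t"
    using wx[OF xt] by simp
qed

theorem theorem2p4:
  fixes a1 a2 :: real and D :: "(real \<times> real) set" and \<alpha> :: "real \<Rightarrow> real \<Rightarrow> real"
  assumes "a2 \<noteq> 0"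
    and "open D"
    and "smooth_FP_solution a1 a2 D \<alpha>"
  shows
    "smooth_FP_solution a1 a2 D (\<lambda>x t. exp (- 2 * a2 * t) *
       (Dt \<alpha> x t - (a2 * x + a1) * Dx \<alpha> x t + 2 * (a2 * x + a1)\<^sup>2 * \<alpha> x t)) \<and>
     smooth_FP_solution a1 a2 D (\<lambda>x t. exp (- a2 * t) / a2 *
       (1 / 2 * Dx \<alpha> x t - (a2 * x + a1) * \<alpha> x t)) \<and>
     smooth_FP_solution a1 a2 D (\<lambda>x t. exp (2 * a2 * t) *
       (Dt \<alpha> x t + (a2 * x + a1) * Dx \<alpha> x t + a2 * \<alpha> x t)) \<and>
     smooth_FP_solution a1 a2 D (\<lambda>x t. Dx \<alpha> x t * exp (a2 * t)) \<and>
     smooth_FP_solution a1 a2 D (\<lambda>x t. Dt \<alpha> x t)"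
proof (intro conjI)
  note D = assms(2) and \<alpha> = assms(3)
  let ?N = "\<lambda>u x t. exp (a2 * t) * Dx u x t"
  let ?M = "\<lambda>u x t. exp (- a2 * t) * (1 / 2 * Dx u x t - (a2 * x + a1) * u x t)"
  have sm: "smooth_on D \<alpha>" using \<alpha> by (simp add: smooth_FP_solution_def)
  note d = smooth_on_DERIV(1)[OF sm] smooth_on_DERIV(1)[OF smooth_on_partials(1)[OF sm]]
  have \<alpha>t: "Dt \<alpha> x t = - a2 * \<alpha> x t - (a2 * x + a1) * Dx \<alpha> x t + 1 / 2 * Dx (Dx \<alpha>) x t"
    if "(x, t) \<in> D" for x t using \<alpha> that by (auto simp: smooth_FP_solution_def)
  have Nx: "Dx (?N \<alpha>) x t = exp (a2 * t) * Dx (Dx \<alpha>) x t" if "(x, t) \<in> D" for x t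
    by (rule partials_eqI) (auto intro!: derivative_eq_intros d that)
  \<comment> \<open>The equation in divergence form: \<open>u_t\<close> is the \<open>x\<close>-derivative of the flux.\<close>
  have Mx: "Dx (?M \<alpha>) x t = exp (- a2 * t) * Dt \<alpha> x t" if "(x, t) \<in> D" for x t
    unfolding \<alpha>t[OF that]
    by (rule partials_eqI) (auto intro!: derivative_eq_intros d that simp: algebra_simps)

  show "smooth_FP_solution a1 a2 D (\<lambda>x t. exp (- 2 * a2 * t) *
       (Dt \<alpha> x t - (a2 * x + a1) * Dx \<alpha> x t + 2 * (a2 * x + a1)\<^sup>2 * \<alpha> x t))"
  proof (rule smooth_FP_solution_cong[OF D
        smooth_FP_solution_scale[OF D
          smooth_FP_solution_raising[OF D smooth_FP_solution_raising[OF D \<alpha>]], of 2]])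
    fix x t assume xt: "(x, t) \<in> D"
    have e: "exp (- 2 * a2 * t) = exp (- a2 * t) * exp (- a2 * t)"
      by (simp flip: exp_add)
    show "2 * ?M (?M \<alpha>) x t = exp (- 2 * a2 * t) *
       (Dt \<alpha> x t - (a2 * x + a1) * Dx \<alpha> x t + 2 * (a2 * x + a1)\<^sup>2 * \<alpha> x t)"
      unfolding Mx[OF xt] e by (simp add: algebra_simps power2_eq_square)
  qed
  show "smooth_FP_solution a1 a2 D (\<lambda>x t. exp (- a2 * t) / a2 *
       (1 / 2 * Dx \<alpha> x t - (a2 * x + a1) * \<alpha> x t))"
    by (rule smooth_FP_solution_cong[OF D
          smooth_FP_solution_scale[OF D smooth_FP_solution_raising[OF D \<alpha>], of "1 / a2"]]) simp
  show "smooth_FP_solution a1 a2 D (\<lambda>x t. exp (2 * a2 * t) *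
       (Dt \<alpha> x t + (a2 * x + a1) * Dx \<alpha> x t + a2 * \<alpha> x t))"
  proof (rule smooth_FP_solution_cong[OF D
        smooth_FP_solution_scale[OF D
          smooth_FP_solution_lowering[OF D smooth_FP_solution_lowering[OF D \<alpha>]], of "1 / 2"]])
    fix x t assume xt: "(x, t) \<in> D"
    have e: "exp (2 * a2 * t) = exp (a2 * t) * exp (a2 * t)"
      by (simp flip: exp_add)
    show "1 / 2 * ?N (?N \<alpha>) x t = exp (2 * a2 * t) *
       (Dt \<alpha> x t + (a2 * x + a1) * Dx \<alpha> x t + a2 * \<alpha> x t)"
      unfolding Nx[OF xt] \<alpha>t[OF xt] e by (simp add: algebra_simps)
  qed
  show "smooth_FP_solution a1 a2 D (\<lambda>x t. Dx \<alpha> x t * exp (a2 * t))"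
    using smooth_FP_solution_lowering[OF D \<alpha>] by (simp add: mult.commute)
  show "smooth_FP_solution a1 a2 D (\<lambda>x t. Dt \<alpha> x t)"
  proof (rule smooth_FP_solution_cong[OF D
        smooth_FP_solution_linear_combination[OF D
          smooth_FP_solution_raising[OF D smooth_FP_solution_lowering[OF D \<alpha>]] \<alpha>, of 1 "- a2"]])
    fix x t assume xt: "(x, t) \<in> D"
    have e: "exp (- a2 * t) * (exp (a2 * t) * z) = z" for z
      by (simp flip: exp_add mult.assoc)
    have "?M (?N \<alpha>) x t = exp (- a2 * t) *
        (exp (a2 * t) * (1 / 2 * Dx (Dx \<alpha>) x t - (a2 * x + a1) * Dx \<alpha> x t))"
      unfolding Nx[OF xt] by (simp add: algebra_simps)
    then show "1 * ?M (?N \<alpha>) x t + - a2 * \<alpha> x t = Dt \<alpha> x t"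
      unfolding e \<alpha>t[OF xt] by simp
  qed
qed

end
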